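(* Let $\mathbf{A}=\mathbf{A}^{\forall}+\mathbf{A}^{\exists}\in\mathbb{IR}^{n\times n}$ be a quantified square interval matrix. If $\mathbf{A}$ is AE regular, then for every quantified interval vector $\mathbf{b}=\mathbf{b}^{\forall}+\mathbf{b}^{\exists}\in\mathbb{IR}^n$ the interval system $\mathbf{A}x=\mathbf{b}$ is AE solvable. The converse is not true in general: there exists a quantified square interval matrix $\mathbf{A}=\mathbf{A}^{\forall}+\mathbf{A}^{\exists}$ that is not AE regular, but for which $\mathbf{A}x=\mathbf{b}$ is AE solvable for every quantified interval vector $\mathbf{b}=\mathbf{b}^{\forall}+\mathbf{b}^{\exists}$.
   Context: An interval matrix is a set $\mathbf{A}=\{A\in\mathbb{R}^{m\times n} : \underline{A}\le A\le\overline{A}\}$, where $\underline{A}\le\overline{A}$ are given real matrices and inequalities are entrywise; $\mathbb{IR}^{m\times n}$ is the set of all $m\times n$ interval matrices, and interval vectors ($\mathbb{IR}^n$) are a special case. In a quantified interval matrix each interval entry is associated with either the universal or the existential quantifier, and $\mathbf{A}$ is split disjointly as $\mathbf{A}=\mathbf{A}^{\forall}+\mathbf{A}^{\exists}$: for each position $(i,j)$, the entry $\mathbf{a}_{ij}$ is put into $\mathbf{A}^{\forall}$ if it is universally quantified and into $\mathbf{A}^{\exists}$ if it is existentially quantified, the corresponding entry of the other matrix being $0$. Quantified interval vectors $\mathbf{b}=\mathbf{b}^{\forall}+\mathbf{b}^{\exists}$ are defined in the same way. $\mathbf{A}$ is AE regular if for every $A^{\forall}\in\mathbf{A}^{\forall}$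 there is $A^{\exists}\in\mathbf{A}^{\exists}$ such that $A^{\forall}+A^{\exists}$ is nonsingular. The interval system $\mathbf{A}x=\mathbf{b}$ is AE solvable if for every $A^{\forall}\in\mathbf{A}^{\forall}$ and every $b^{\forall}\in\mathbf{b}^{\forall}$ there are $A^{\exists}\in\mathbf{A}^{\exists}$ and $b^{\exists}\in\mathbf{b}^{\exists}$ such that the linear system $(A^{\forall}+A^{\exists})x=b^{\forall}+b^{\exists}$ has a solution $x\in\mathbb{R}^n$. *)

theory Defs
  imports "Jordan_Normal_Form.Matrix"
begin

datatype quantifier = Universal | Existential

text \<open>A quantified interval matrix or vector is given by its two bounds and the quantifier of each
  entry; the quantifiers at positions outside the index range are irrelevant. The order on
  \<^typ>\<open>real mat\<close> and \<^typ>\<open>real vec\<close> is the entrywise one, restricted to equal dimensions, so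
  that the interval \<^term>\<open>{L..U}\<close> is the interval matrix (vector) with these bounds.\<close>

record quantified_mat =
  lower_mat :: "real mat"
  upper_mat :: "real mat"
  quant_mat :: "nat \<times> nat \<Rightarrow> quantifier"

record quantified_vec =
  lower_vec :: "real vec"
  upper_vec :: "real vec"
  quant_vec :: "nat \<Rightarrow> quantifier"

definition carrier_quantified_mat :: "nat \<Rightarrow> nat \<Rightarrow> quantified_mat set" where
  "carrier_quantified_mat m n =
    {A. lower_mat A \<in> carrier_mat m n \<and> upper_mat A \<in> carrier_mat m n \<and> lower_mat A \<le> upper_mat A}"

definition carrier_quantified_vec :: "nat \<Rightarrow> quantified_vec set" where
  "carrier_quantified_vec n =
    {b. lower_vec b \<in> carrier_vec n \<and> upper_vec b \<in> carrier_vec n \<and> lower_vec b \<le> upper_vec b}"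

definition restrict_mat :: "(nat \<times> nat) set \<Rightarrow> real mat \<Rightarrow> real mat" where
  "restrict_mat S M = mat (dim_row M) (dim_col M) (\<lambda>ij. if ij \<in> S then M $$ ij else 0)"

definition restrict_vec :: "nat set \<Rightarrow> real vec \<Rightarrow> real vec" where
  "restrict_vec S v = vec (dim_vec v) (\<lambda>i. if i \<in> S then v $ i else 0)"

text \<open>The interval matrix (vector) of all entries with quantifier \<^term>\<open>q\<close>, the other entries
  being zero.\<close>

definition part_mat :: "quantifier \<Rightarrow> quantified_mat \<Rightarrow> real mat set" where
  "part_mat q A =
    (let S = {ij. quant_mat A ij = q} in {restrict_mat S (lower_mat A)..restrict_mat S (upper_mat A)})"

definition part_vec :: "quantifier \<Rightarrow> quantified_vec \<Rightarrow> real vec set" where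
  "part_vec q b =
    (let S = {i. quant_vec b i = q} in {restrict_vec S (lower_vec b)..restrict_vec S (upper_vec b)})"

definition AE_regular :: "quantified_mat \<Rightarrow> bool" where
  "AE_regular A \<longleftrightarrow>
    (\<forall>A\<^sub>1 \<in> part_mat Universal A. \<exists>A\<^sub>2 \<in> part_mat Existential A. invertible_mat (A\<^sub>1 + A\<^sub>2))"

definition AE_solvable :: "quantified_mat \<Rightarrow> quantified_vec \<Rightarrow> bool" where
  "AE_solvable A b \<longleftrightarrow>
    (\<forall>A\<^sub>1 \<in> part_mat Universal A. \<forall>b\<^sub>1 \<in> part_vec Universal b.
      \<exists>A\<^sub>2 \<in> part_mat Existential A. \<exists>b\<^sub>2 \<in> part_vec Existential b.
        \<exists>x \<in> carrier_vec (dim_col (lower_mat A)). (A\<^sub>1 + A\<^sub>2) *\<^sub>v x = b\<^sub>1 + b\<^sub>2)"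

end

theory Submission
  imports Defs
begin

text \<open>If the matrix is AE regular, then its inverse yields a solution. Conversely, in the
  2-by-2 matrix with first column \<open>[-1, 1]\<close> (existential) and second column zero, every choice is
  singular, but the first column can be chosen after the right-hand side \<open>b\<close>, as \<open>b / t\<close> for a
  large \<open>t\<close>; then the vector with all entries \<open>t\<close> is a solution.\<close>

lemma dim_restrict_mat [simp]:
  "dim_row (restrict_mat S M) = dim_row M" "dim_col (restrict_mat S M) = dim_col M"
  by (simp_all add: restrict_mat_def)

lemma dim_restrict_vec [simp]: "dim_vec (restrict_vec S v) = dim_vec v"
  by (simp add: restrict_vec_def)

text \<open>The order on matrices includes equality of dimensions, so being above the restricted
  lower bound already fixes the size of \<open>M\<close>.\<close>

lemma part_mat_carrier:
  assumes A: "A \<in> carrier_quantified_mat m n" and M: "M \<in> part_mat q A"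
  shows "M \<in> carrier_mat m n"
proof -
  have "restrict_mat {ij. quant_mat A ij = q} (lower_mat A) \<le> M"
    using M by (simp add: part_mat_def Let_def)
  then have "dim_row M = dim_row (lower_mat A)" "dim_col M = dim_col (lower_mat A)"
    by (simp_all add: less_eq_mat_def)
  moreover have "lower_mat A \<in> carrier_mat m n"
    using A by (simp add: carrier_quantified_mat_def)
  ultimately show ?thesis by (metis carrier_matD carrier_matI)
qed

lemma part_vec_carrier:
  assumes b: "b \<in> carrier_quantified_vec n" and v: "v \<in> part_vec q b"
  shows "v \<in> carrier_vec n"
proof -
  have "restrict_vec {i. quant_vec b i = q} (lower_vec b) \<le> v"
    using v by (simp add: part_vec_def Let_def)
  then have "dim_vec v = dim_vec (lower_vec b)"
    by (simp add: less_eq_vec_def)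
  moreover have "lower_vec b \<in> carrier_vec n"
    using b by (simp add: carrier_quantified_vec_def)
  ultimately show ?thesis by (metis carrier_vecD carrier_vecI)
qed

lemma part_vec_nonempty:
  assumes "b \<in> carrier_quantified_vec n"
  obtains v where "v \<in> part_vec q b"
proof
  show "restrict_vec {i. quant_vec b i = q} (lower_vec b) \<in> part_vec q b"
    using assms
    by (auto simp: carrier_quantified_vec_def part_vec_def Let_def less_eq_vec_def restrict_vec_def)
qed

lemma invertible_mat_solution:
  fixes M :: "real mat"
  assumes M: "M \<in> carrier_mat n n" "invertible_mat M" and b: "b \<in> carrier_vec n"
  obtains x where "x \<in> carrier_vec n" "M *\<^sub>v x = b"
proof -
  obtain B where B: "M * B = 1\<^sub>m n" "B * M = 1\<^sub>m (dim_row B)"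
    using M by (auto simp: invertible_mat_def inverts_mat_def)
  \<comment> \<open>\<open>invertible_mat\<close> does not state the size of the inverse. It follows
    by comparing column counts: \<open>M * B\<close> gives \<open>dim_col B = n\<close>, and
    \<open>B * M\<close> gives \<open>dim_row B = n\<close>.\<close>
  have "B \<in> carrier_mat n n"
    using B M by (metis carrier_matD(2) carrier_matI index_mult_mat(3) index_one_mat(3))
  then have "B *\<^sub>v b \<in> carrier_vec n" "M *\<^sub>v (B *\<^sub>v b) = b"
    using B M b by (auto simp flip: assoc_mult_mat_vec)
  then show thesis by (rule that)
qed

text \<open>Regularity supplies \<open>A\<^sub>2\<close> from \<open>A\<^sub>1\<close> alone. The
  resulting nonsingular matrix solves the system for every right-hand side, so any element of the
  existential part of \<open>b\<close> serves as \<open>b\<^sub>2\<close>.\<close>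

lemma AE_regular_imp_AE_solvable:
  assumes A: "A \<in> carrier_quantified_mat n n" and reg: "AE_regular A"
    and b: "b \<in> carrier_quantified_vec n"
  shows "AE_solvable A b"
  unfolding AE_solvable_def
proof (intro ballI)
  fix A\<^sub>1 b\<^sub>1
  assume A1: "A\<^sub>1 \<in> part_mat Universal A" and b1: "b\<^sub>1 \<in> part_vec Universal b"
  obtain A\<^sub>2 where A2: "A\<^sub>2 \<in> part_mat Existential A" "invertible_mat (A\<^sub>1 + A\<^sub>2)"
    using reg A1 by (auto simp: AE_regular_def)
  obtain b\<^sub>2 where b2: "b\<^sub>2 \<in> part_vec Existential b"
    using part_vec_nonempty[OF b] .
  have "A\<^sub>1 + A\<^sub>2 \<in> carrier_mat n n" "b\<^sub>1 + b\<^sub>2 \<in> carrier_vec n"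
    using part_mat_carrier[OF A] part_vec_carrier[OF b] A1 A2 b1 b2 by auto
  then obtain x where "x \<in> carrier_vec n" "(A\<^sub>1 + A\<^sub>2) *\<^sub>v x = b\<^sub>1 + b\<^sub>2"
    using A2(2) by (blast elim: invertible_mat_solution)
  moreover have "dim_col (lower_mat A) = n"
    using A by (auto simp: carrier_quantified_mat_def)
  ultimately show "\<exists>A\<^sub>2 \<in> part_mat Existential A. \<exists>b\<^sub>2 \<in> part_vec Existential b.
      \<exists>x \<in> carrier_vec (dim_col (lower_mat A)). (A\<^sub>1 + A\<^sub>2) *\<^sub>v x = b\<^sub>1 + b\<^sub>2"
    using A2(1) b2 by blast
qed

text \<open>A zero column \<open>j\<close> of \<open>M\<close> stays zero in \<open>B * M\<close>
  for every \<open>B\<close>, whereas the identity has a 1 at position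
  \<open>(j, j)\<close>.\<close>

lemma not_invertible_zero_col:
  fixes M :: "real mat"
  assumes M: "M \<in> carrier_mat n n" and j: "j < n" and col: "col M j = 0\<^sub>v n"
  shows "\<not> invertible_mat M"
proof
  assume "invertible_mat M"
  then obtain B where B: "M * B = 1\<^sub>m n" "B * M = 1\<^sub>m (dim_row B)"
    using M by (auto simp: invertible_mat_def inverts_mat_def)
  have B': "B \<in> carrier_mat n n"
    using B M by (metis carrier_matD(2) carrier_matI index_mult_mat(3) index_one_mat(3))
  have "(B * M) $$ (j, j) = 0"
    using B' M j col by simp
  then show False
    using B(2) B' j by simp
qed

definition first_col_mat :: "(nat \<Rightarrow> real) \<Rightarrow> real mat" where
  "first_col_mat f = mat 2 2 (\<lambda>(i, j). if j = 0 then f i else 0)"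

text \<open>Every quantifier is existential, so the universal part is only the zero matrix and the
  whole matrix may depend on the universal part of the right-hand side. Both bounds vanish in the
  second column, which is therefore fixed to zero.\<close>

definition first_col_quantified_mat :: quantified_mat where
  "first_col_quantified_mat =
    \<lparr>lower_mat = first_col_mat (\<lambda>_. - 1), upper_mat = first_col_mat (\<lambda>_. 1),
     quant_mat = (\<lambda>_. Existential)\<rparr>"

lemma first_col_quantified_mat_carrier:
  "first_col_quantified_mat \<in> carrier_quantified_mat 2 2"
  by (auto simp: first_col_quantified_mat_def first_col_mat_def carrier_quantified_mat_def
      less_eq_mat_def)

lemma part_mat_Universal_first_col: "part_mat Universal first_col_quantified_mat = {0\<^sub>m 2 2}"
proof -
  have "restrict_mat {} (first_col_mat f) = 0\<^sub>m 2 2" for f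
    by (auto simp: restrict_mat_def first_col_mat_def)
  then show ?thesis
    by (simp add: part_mat_def first_col_quantified_mat_def)
qed

lemma part_mat_Existential_first_col:
  "part_mat Existential first_col_quantified_mat =
    {first_col_mat (\<lambda>_. - 1)..first_col_mat (\<lambda>_. 1)}"
proof -
  have "restrict_mat UNIV M = M" for M
    by (auto simp: restrict_mat_def)
  then show ?thesis
    by (simp add: part_mat_def first_col_quantified_mat_def)
qed

lemma not_AE_regular_first_col: "\<not> AE_regular first_col_quantified_mat"
proof -
  have "\<not> invertible_mat (0\<^sub>m 2 2 + M)" if "M \<in> part_mat Existential first_col_quantified_mat" for M
  proof (rule not_invertible_zero_col[where n = 2 and j = 1])
    have M: "M \<in> carrier_mat 2 2"
      using part_mat_carrier[OF first_col_quantified_mat_carrier that] .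
    then show "0\<^sub>m 2 2 + M \<in> carrier_mat 2 2"
      by simp
    \<comment> \<open>The entry lies between two bounds that are both 0. They are compared for a
      general column \<open>j\<close> first and then specialised to \<open>j = 1\<close>.\<close>
    have "M $$ (i, 1) = 0" if "i < 2" for i
    proof -
      have "first_col_mat (\<lambda>_. - 1) \<le> M" "M \<le> first_col_mat (\<lambda>_. 1)"
        using \<open>M \<in> part_mat _ _\<close> by (simp_all add: part_mat_Existential_first_col)
      then have "first_col_mat (\<lambda>_. - 1) $$ (i, j) \<le> M $$ (i, j) \<and>
          M $$ (i, j) \<le> first_col_mat (\<lambda>_. 1) $$ (i, j)" if "j < 2" for j
        using M \<open>i < 2\<close> that unfolding less_eq_mat_def by (simp add: first_col_mat_def)
      from this[of 1] show ?thesis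
        using \<open>i < 2\<close> by (simp add: first_col_mat_def)
    qed
    with M show "col (0\<^sub>m 2 2 + M) 1 = 0\<^sub>v 2"
      by (intro eq_vecI) auto
  qed simp
  then show ?thesis
    by (auto simp: AE_regular_def part_mat_Universal_first_col)
qed

lemma AE_solvable_first_col:
  assumes b: "b \<in> carrier_quantified_vec 2"
  shows "AE_solvable first_col_quantified_mat b"
  unfolding AE_solvable_def part_mat_Universal_first_col
proof (intro ballI)
  fix A\<^sub>1 :: "real mat" and b\<^sub>1 :: "real vec"
  assume A1: "A\<^sub>1 \<in> {0\<^sub>m 2 2}" and b1: "b\<^sub>1 \<in> part_vec Universal b"
  obtain b\<^sub>2 where b2: "b\<^sub>2 \<in> part_vec Existential b"
    using part_vec_nonempty[OF b] .
  define c where "c = b\<^sub>1 + b\<^sub>2"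
  have c: "c \<in> carrier_vec 2"
    using part_vec_carrier[OF b] b1 b2 by (auto simp: c_def)
  \<comment> \<open>The absolute values make \<open>t\<close> dominate both entries of
    \<open>c\<close>, so that each quotient \<open>c $ i / t\<close> lies between -1 and 1. The
    summand 1 keeps \<open>t\<close> positive even when \<open>c\<close> is zero.\<close>
  define t where "t = 1 + \<bar>c $ 0\<bar> + \<bar>c $ 1\<bar>"
  define A\<^sub>2 where "A\<^sub>2 = first_col_mat (\<lambda>i. c $ i / t)"
  have t: "t > 0" "\<bar>c $ i\<bar> \<le> t" if "i < 2" for i
    using that by (auto simp: t_def less_2_cases_iff)
  then have "- 1 \<le> c $ i / t" "c $ i / t \<le> 1" if "i < 2" for i
    using t[OF that] by (simp_all add: le_divide_eq divide_le_eq abs_le_iff)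
  then have "A\<^sub>2 \<in> part_mat Existential first_col_quantified_mat"
    by (auto simp: part_mat_Existential_first_col A\<^sub>2_def first_col_mat_def less_eq_mat_def)
  \<comment> \<open>As \<open>A\<^sub>1\<close> is zero, entry \<open>i\<close> of the product is
    \<open>(c $ i / t) * t + 0 * t\<close>, and \<open>t\<close> cancels because it is
    positive.\<close>
  moreover have "(A\<^sub>1 + A\<^sub>2) *\<^sub>v vec 2 (\<lambda>_. t) = c"
  proof (rule eq_vecI)
    fix i assume "i < dim_vec c"
    then show "((A\<^sub>1 + A\<^sub>2) *\<^sub>v vec 2 (\<lambda>_. t)) $ i = c $ i"
      using A1 c t[of i]
      by (simp add: A\<^sub>2_def first_col_mat_def scalar_prod_def numeral_2_eq_2)
  qed (use A1 c in \<open>simp add: A\<^sub>2_def first_col_mat_def\<close>)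
  moreover have "vec 2 (\<lambda>_. t) \<in> carrier_vec (dim_col (lower_mat first_col_quantified_mat))"
    by (simp add: first_col_quantified_mat_def first_col_mat_def)
  ultimately show "\<exists>A\<^sub>2 \<in> part_mat Existential first_col_quantified_mat.
      \<exists>b\<^sub>2 \<in> part_vec Existential b.
        \<exists>x \<in> carrier_vec (dim_col (lower_mat first_col_quantified_mat)).
          (A\<^sub>1 + A\<^sub>2) *\<^sub>v x = b\<^sub>1 + b\<^sub>2"
    using b2 unfolding c_def by blast
qed

theorem theorem3:
  shows "(\<forall>n. \<forall>A \<in> carrier_quantified_mat n n.
            AE_regular A \<longrightarrow> (\<forall>b \<in> carrier_quantified_vec n. AE_solvable A b)) \<and>
         (\<exists>n. \<exists>A \<in> carrier_quantified_mat n n.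
            \<not> AE_regular A \<and> (\<forall>b \<in> carrier_quantified_vec n. AE_solvable A b))"
  using AE_regular_imp_AE_solvable first_col_quantified_mat_carrier not_AE_regular_first_col
    AE_solvable_first_col by blast

end
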